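(* Let $\Omega\subset\mathbb{H}^N$ be a bounded extension domain and $f\in L^\infty(\Omega)$. Let $u_0\in\mathcal{Z}$ with $u_0\in L^\infty(\mathbb{H}^N\setminus\Omega)$, and let $\phi\in\mathcal{Z}$ with $u_0\le\phi$ a.e. in $\mathbb{H}^N$ and $\mathfrak{L}_{\mathcal K}\phi\in L^\infty(\Omega)$. Put $$\mathcal{M}_\phi=\{u\in\mathcal{Z}: u=u_0 \text{ a.e. in }\Omega^c,\ u\le\phi\text{ a.e. in }\Omega\}.$$ If $u\in\mathcal{M}_\phi$ is a solution of the variational inequality $$\int_{\mathcal S}(u(\xi)-u(\eta))\big((v-u)(\xi)-(v-u)(\eta)\big)\mathcal K(\eta^{-1}\xi)\,d\xi\,d\eta\ \ge\ \int_\Omega f(v-u)\,d\xi\qquad\text{for all }v\in\mathcal{M}_\phi,$$ then $$0\le-\int_{\mathcal S}(u(\xi)-u(\eta))(\psi(\xi)-\psi(\eta))\mathcal K(\eta^{-1}\xi)\,d\xi\,d\eta+\int_\Omega f\psi\,d\xi\ \le\ \int_\Omega(\mathfrak{L}_{\mathcal K}\phi+f)^+\psi\,d\xi$$ for all non-negative $\psi\in C_c^\infty(\Omega)$.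
   Context: $\mathbb{H}^N=\mathbb{R}^N\times\mathbb{R}^N\times\mathbb{R}$ ($N\ge1$) is the Heisenberg group with law $(x,y,t)\cdot(x',y',t')=(x+x',y+y',t+t'+2(\langle x',y\rangle-\langle x,y'\rangle))$, identity $0$, homogeneous norm $|(x,y,t)|=(t^2+(|x|^2+|y|^2)^2)^{1/4}$, Lebesgue (Haar) measure, and homogeneous dimension $Q=2N+2$. Products $\xi\eta$ and inverses $\eta^{-1}$ are in this group. Fix $s\in(0,1)$ (so $Q>2s$). The kernel $\mathcal K:\mathbb{H}^N\setminus\{0\}\to(0,\infty)$ is measurable and satisfies: $\theta\mathcal K\in L^1(\mathbb{H}^N)$ with $\theta(\xi)=\min\{1,|\xi|^2\}$; there is $\mu>0$ with $\mathcal K(\xi)\ge\mu|\xi|^{-(Q+2s)}$ for all $\xi\ne0$; and $\mathcal K(\xi)=\mathcal K(\xi^{-1})$ for all $\xi\neq 0$. $\Omega^c=\mathbb{H}^N\setminus\Omega$ and $\mathcal S=(\mathbb{H}^N\times\mathbb{H}^N)\setminus(\Omega^c\times\Omega^c)$. $\mathcal Z$ is the space of measurable $u:\mathbb{H}^N\to\mathbb{R}$ with $u\in L^2(\Omega)$ and $(u(\xi)-u(\eta))\sqrt{\mathcal K(\eta^{-1}\xi)}\in L^2(\mathcal S,d\xi\,d\eta)$; $\mathcal Z_0=\{u\in\mathcal Z:u=0\text{ a.e. in }\Omega^c\}$. The operator $\mathfrak{L}_{\mathcal K}$ is understood weakly: for $\phi\in\mathcal Z$, "$\mathfrak{L}_{\mathcal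 K}\phi\in L^\infty(\Omega)$" means that there is $g\in L^\infty(\Omega)$ with $-\int_{\mathcal S}(\phi(\xi)-\phi(\eta))(v(\xi)-v(\eta))\mathcal K(\eta^{-1}\xi)\,d\xi\,d\eta=\int_\Omega g\,v\,d\xi$ for all $v\in\mathcal Z_0$, and then $\mathfrak{L}_{\mathcal K}\phi:=g$. Extension domain: for an open set $U\subseteq\mathbb{H}^N$, $W^{s,2}(U)$ is the space of $u\in L^2(U)$ with $\int_{U\times U}\frac{|u(\xi)-u(\eta)|^2}{|\eta^{-1}\xi|^{Q+2s}}d\xi d\eta<\infty$, normed by $\|u\|_{W^{s,2}(U)}=\|u\|_{L^2(U)}+\big(\int_{U\times U}\frac{|u(\xi)-u(\eta)|^2}{|\eta^{-1}\xi|^{Q+2s}}d\xi d\eta\big)^{1/2}$. $\Omega$ is an extension domain if it is open and connected and there is $C>0$ such that every $u\in W^{s,2}(\Omega)$ has an extension $\tilde u\in W^{s,2}(\mathbb{H}^N)$ with $\tilde u=u$ a.e. in $\Omega$ and $\|\tilde u\|_{W^{s,2}(\mathbb{H}^N)}\le C\|u\|_{W^{s,2}(\Omega)}$. $a^+=\max\{a,0\}$. *)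

theory Defs
  imports "HOL-Analysis.Analysis"
begin

section \<open>The Heisenberg group\<close>

text \<open>
  The topology and Lebesgue measure are those of the Euclidean space underlying the product type;
  \<open>+\<close>, \<open>-\<close> and \<open>norm\<close> on this type are the Euclidean ones and not the group operations or
  the homogeneous norm.
\<close>

type_synonym 'n heis = "(real ^ 'n) \<times> (real ^ 'n) \<times> real"

fun heis_mult :: "'n::finite heis \<Rightarrow> 'n heis \<Rightarrow> 'n heis" where
  "heis_mult (x, y, t) (x', y', t') = (x + x', y + y', t + t' + 2 * (x' \<bullet> y - x \<bullet> y'))"

fun heis_inv :: "'n::finite heis \<Rightarrow> 'n heis" where
  "heis_inv (x, y, t) = (- x, - y, - t)"

fun heis_norm :: "'n::finite heis \<Rightarrow> real" where
  "heis_norm (x, y, t) = (t\<^sup>2 + ((norm x)\<^sup>2 + (norm y)\<^sup>2)\<^sup>2) powr (1 / 4)"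

definition hom_dim :: "'n::finite itself \<Rightarrow> real" where
  "hom_dim _ = 2 * real CARD('n) + 2"

lemma heis_mult_assoc: "heis_mult (heis_mult a b) c = heis_mult a (heis_mult b c)"
  by (cases a; cases b; cases c) (simp add: inner_simps algebra_simps)

lemma heis_mult_0 [simp]: "heis_mult 0 a = a" "heis_mult a 0 = a"
  by (cases a; simp add: zero_prod_def)+

lemma heis_mult_inv [simp]: "heis_mult (heis_inv a) a = 0" "heis_mult a (heis_inv a) = 0"
  by (cases a; simp add: zero_prod_def inner_commute)+

section \<open>Lebesgue spaces\<close>

definition in_L2 :: "'a::euclidean_space set \<Rightarrow> ('a \<Rightarrow> real) \<Rightarrow> bool" where
  "in_L2 A f \<longleftrightarrow>
     f \<in> borel_measurable (lebesgue_on A) \<and> integrable (lebesgue_on A) (\<lambda>x. (f x)\<^sup>2)"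

definition in_Linf :: "'a::euclidean_space set \<Rightarrow> ('a \<Rightarrow> real) \<Rightarrow> bool" where
  "in_Linf A f \<longleftrightarrow>
     f \<in> borel_measurable (lebesgue_on A) \<and> (\<exists>C. AE x in lebesgue_on A. \<bar>f x\<bar> \<le> C)"

section \<open>Test functions\<close>

primrec C_k :: "nat \<Rightarrow> ('a::euclidean_space \<Rightarrow> real) \<Rightarrow> bool" where
  "C_k 0 f \<longleftrightarrow> continuous_on UNIV f"
| "C_k (Suc k) f \<longleftrightarrow>
     (\<forall>x. f differentiable (at x)) \<and> (\<forall>v. C_k k (\<lambda>x. frechet_derivative f (at x) v))"

text \<open>Elements of $C_c^\infty(\Omega)$ are regarded as functions on the whole space, vanishing
  outside \<open>\<Omega>\<close>.\<close>

definition Cc_infinity :: "'a::euclidean_space set \<Rightarrow> ('a \<Rightarrow> real) set" where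
  "Cc_infinity \<Omega> =
     {\<psi>. (\<forall>k. C_k k \<psi>) \<and> compact (closure {x. \<psi> x \<noteq> 0}) \<and> closure {x. \<psi> x \<noteq> 0} \<subseteq> \<Omega>}"

section \<open>Kernels, function spaces and the operator\<close>

text \<open>A kernel is a total function here; its value at \<open>0\<close> is unconstrained. It only enters below
  through the diagonal, where it is multiplied by \<open>0\<close>.\<close>

definition kernel :: "real \<Rightarrow> ('n::finite heis \<Rightarrow> real) \<Rightarrow> bool" where
  "kernel s K \<longleftrightarrow>
     K \<in> borel_measurable (lebesgue_on (- {0})) \<and>
     (\<forall>\<xi>. \<xi> \<noteq> 0 \<longrightarrow> 0 < K \<xi>) \<and>
     integrable (lebesgue_on (- {0})) (\<lambda>\<xi>. min 1 ((heis_norm \<xi>)\<^sup>2) * K \<xi>) \<and>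
     (\<exists>\<mu>>0. \<forall>\<xi>. \<xi> \<noteq> 0 \<longrightarrow> K \<xi> \<ge> \<mu> * heis_norm \<xi> powr (- (hom_dim TYPE('n) + 2 * s))) \<and>
     (\<forall>\<xi>. \<xi> \<noteq> 0 \<longrightarrow> K \<xi> = K (heis_inv \<xi>))"

definition cross_set :: "'n::finite heis set \<Rightarrow> ('n heis \<times> 'n heis) set" where
  "cross_set \<Omega> = UNIV - (- \<Omega>) \<times> (- \<Omega>)"

definition Z_space :: "'n::finite heis set \<Rightarrow> ('n heis \<Rightarrow> real) \<Rightarrow> ('n heis \<Rightarrow> real) set" where
  "Z_space \<Omega> K =
     {u. u \<in> borel_measurable lebesgue \<and> in_L2 \<Omega> u \<and>
         in_L2 (cross_set \<Omega>) (\<lambda>(\<xi>, \<eta>). (u \<xi> - u \<eta>) * sqrt (K (heis_mult (heis_inv \<eta>) \<xi>)))}"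

definition Z0_space :: "'n::finite heis set \<Rightarrow> ('n heis \<Rightarrow> real) \<Rightarrow> ('n heis \<Rightarrow> real) set" where
  "Z0_space \<Omega> K = {u \<in> Z_space \<Omega> K. AE \<xi> in lebesgue_on (- \<Omega>). u \<xi> = 0}"

definition energy ::
  "'n::finite heis set \<Rightarrow> ('n heis \<Rightarrow> real) \<Rightarrow> ('n heis \<Rightarrow> real) \<Rightarrow> ('n heis \<Rightarrow> real) \<Rightarrow> real" where
  "energy \<Omega> K u v =
     (\<integral>(\<xi>, \<eta>). (u \<xi> - u \<eta>) * (v \<xi> - v \<eta>) * K (heis_mult (heis_inv \<eta>) \<xi>)
        \<partial>lebesgue_on (cross_set \<Omega>))"

text \<open>\<open>has_L_op \<Omega> K \<phi> g\<close> says that $\mathfrak{L}_K \phi \in L^\infty(\Omega)$ with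
  $\mathfrak{L}_K \phi = g$; it is a relation because \<open>g\<close> is only determined almost everywhere
  on \<open>\<Omega>\<close>.\<close>

definition has_L_op ::
  "'n::finite heis set \<Rightarrow> ('n heis \<Rightarrow> real) \<Rightarrow> ('n heis \<Rightarrow> real) \<Rightarrow> ('n heis \<Rightarrow> real) \<Rightarrow> bool" where
  "has_L_op \<Omega> K \<phi> g \<longleftrightarrow>
     in_Linf \<Omega> g \<and>
     (\<forall>v \<in> Z0_space \<Omega> K. - energy \<Omega> K \<phi> v = (\<integral>\<xi>. g \<xi> * v \<xi> \<partial>lebesgue_on \<Omega>))"

definition obstacle_set ::
  "'n::finite heis set \<Rightarrow> ('n heis \<Rightarrow> real) \<Rightarrow> ('n heis \<Rightarrow> real) \<Rightarrow> ('n heis \<Rightarrow> real) \<Rightarrow>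
   ('n heis \<Rightarrow> real) set" where
  "obstacle_set \<Omega> K u0 \<phi> =
     {u \<in> Z_space \<Omega> K. (AE \<xi> in lebesgue_on (- \<Omega>). u \<xi> = u0 \<xi>) \<and>
                       (AE \<xi> in lebesgue_on \<Omega>. u \<xi> \<le> \<phi> \<xi>)}"

section \<open>Extension domains\<close>

text \<open>On the diagonal the quotient is \<open>0 / 0 = 0\<close>.\<close>

definition gagliardo :: "real \<Rightarrow> ('n::finite heis \<Rightarrow> real) \<Rightarrow> 'n heis \<times> 'n heis \<Rightarrow> real" where
  "gagliardo s u = (\<lambda>(\<xi>, \<eta>).
     \<bar>u \<xi> - u \<eta>\<bar>\<^sup>2 / heis_norm (heis_mult (heis_inv \<eta>) \<xi>) powr (hom_dim TYPE('n) + 2 * s))"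

definition W_space :: "real \<Rightarrow> 'n::finite heis set \<Rightarrow> ('n heis \<Rightarrow> real) set" where
  "W_space s U = {u. in_L2 U u \<and> integrable (lebesgue_on (U \<times> U)) (gagliardo s u)}"

definition W_norm :: "real \<Rightarrow> 'n::finite heis set \<Rightarrow> ('n heis \<Rightarrow> real) \<Rightarrow> real" where
  "W_norm s U u =
     sqrt (\<integral>\<xi>. (u \<xi>)\<^sup>2 \<partial>lebesgue_on U) + sqrt (\<integral>p. gagliardo s u p \<partial>lebesgue_on (U \<times> U))"

definition extension_domain :: "real \<Rightarrow> 'n::finite heis set \<Rightarrow> bool" where
  "extension_domain s \<Omega> \<longleftrightarrow>
     open \<Omega> \<and> connected \<Omega> \<and>
     (\<exists>C>0. \<forall>u \<in> W_space s \<Omega>. \<exists>w \<in> W_space s UNIV.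
        (AE \<xi> in lebesgue_on \<Omega>. w \<xi> = u \<xi>) \<and> W_norm s UNIV w \<le> C * W_norm s \<Omega> u)"

end

theory Submission
  imports Defs
begin

text \<open>
  The lower bound is the variational inequality tested with \<open>u - \<psi>\<close>. For the upper bound take
  \<open>t > 0\<close> and truncate \<open>u + t\<psi>\<close> at the obstacle: with \<open>p = (u + t\<psi> - \<phi>)\<^sup>+\<close> the competitor
  \<open>v = u + t\<psi> - p\<close> is admissible and \<open>0 \<le> p \<le> t\<psi>\<close>, so it remains to bound the energy \<open>E(u, p)\<close>
  from below. Up to an error \<open>t\<^sup>2 E(\<psi>, \<psi>) / 4\<close> it is at least \<open>E(\<phi>, p)\<close>, which is minus the integral
  of \<open>L\<phi> p\<close>; dividing by \<open>t\<close> and letting \<open>t\<close> tend to \<open>0\<close> gives the claim. No penalised problem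
  has to be solved.

  That \<open>\<psi>\<close> has finite energy follows from left invariance of Lebesgue measure together with
  \<open>|\<psi>(\<xi>) - \<psi>(\<eta>)|\<^sup>2 \<le> C min {1, |\<eta>\<^sup>-\<^sup>1\<xi>|\<^sup>2}\<close>.
\<close>

subsection \<open>Lebesgue measure and the group law\<close>

lemma heis_mult_eq:
  "heis_mult a b = (fst a + fst b, fst (snd a) + fst (snd b),
     snd (snd a) + snd (snd b) + 2 * (fst b \<bullet> fst (snd a) - fst a \<bullet> fst (snd b)))"
  by (cases a; cases b) simp

lemma heis_inv_eq: "heis_inv a = - a"
  by (cases a) simp

lemma heis_norm_eq:
  "heis_norm a = ((snd (snd a))\<^sup>2 + ((norm (fst a))\<^sup>2 + (norm (fst (snd a)))\<^sup>2)\<^sup>2) powr (1 / 4)"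
  by (cases a) simp

lemma continuous_on_heis_mult [continuous_intros]:
  assumes "continuous_on S f" "continuous_on S g"
  shows "continuous_on S (\<lambda>x. heis_mult (f x) (g x))"
  unfolding heis_mult_eq using assms by (intro continuous_intros)

lemma nn_integral_lborel_translate:
  fixes g :: "'a::euclidean_space \<Rightarrow> ennreal"
  assumes [measurable]: "g \<in> borel_measurable borel"
  shows "(\<integral>\<^sup>+x. g (c + x) \<partial>lborel) = (\<integral>\<^sup>+x. g x \<partial>lborel)"
proof -
  have "(\<integral>\<^sup>+x. g x \<partial>lborel) = (\<integral>\<^sup>+x. g x \<partial>distr lborel borel ((+) c))"
    by (simp add: lborel_distr_plus)
  also have "\<dots> = (\<integral>\<^sup>+x. g (c + x) \<partial>lborel)"
    by (subst nn_integral_distr) auto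
  finally show ?thesis by simp
qed

lemma nn_integral_lborel_pair:
  fixes g :: "'a::euclidean_space \<times> 'b::euclidean_space \<Rightarrow> ennreal"
  assumes "g \<in> borel_measurable borel"
  shows "(\<integral>\<^sup>+x. g x \<partial>lborel) = (\<integral>\<^sup>+a. \<integral>\<^sup>+b. g (a, b) \<partial>lborel \<partial>lborel)"
  using lborel.nn_integral_fst[of g lborel] assms
  by (simp add: lborel_prod)

text \<open>Left translations are shears.\<close>

lemma nn_integral_heis_mult_left:
  fixes g :: "'n::finite heis \<Rightarrow> ennreal"
  assumes [measurable]: "g \<in> borel_measurable borel"
  shows "(\<integral>\<^sup>+\<xi>. g (heis_mult \<zeta> \<xi>) \<partial>lborel) = (\<integral>\<^sup>+\<xi>. g \<xi> \<partial>lborel)"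
proof -
  obtain a b c where \<zeta>: "\<zeta> = (a, b, c)" by (cases \<zeta>)
  \<comment> \<open>With the horizontal coordinates fixed, the twisted term of the group law is a
    constant \<open>r\<close>. Integrating the vertical coordinate innermost therefore absorbs it,
    and only Euclidean translations in \<open>y\<close> and \<open>x\<close> remain.\<close>
  have shift: "(\<integral>\<^sup>+t. g (x, y, c + t + r) \<partial>lborel) = (\<integral>\<^sup>+t. g (x, y, t) \<partial>lborel)"
    for x y r
    using nn_integral_lborel_translate[of "\<lambda>t. g (x, y, t)" "c + r"]
    by (simp add: algebra_simps)
  have "(\<integral>\<^sup>+\<xi>. g (heis_mult \<zeta> \<xi>) \<partial>lborel) =
      (\<integral>\<^sup>+x. \<integral>\<^sup>+y. \<integral>\<^sup>+t. g (a + x, b + y, t) \<partial>lborel \<partial>lborel \<partial>lborel)"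
  proof -
    have "(\<lambda>\<xi>. g (heis_mult (a, b, c) \<xi>)) \<in> borel_measurable borel"
      by (intro measurable_compose[OF _ assms] borel_measurable_continuous_onI continuous_intros)
    then show ?thesis
      unfolding \<zeta> by (simp add: nn_integral_lborel_pair shift)
  qed
  also have "\<dots> = (\<integral>\<^sup>+x. \<integral>\<^sup>+y. \<integral>\<^sup>+t. g (a + x, y, t) \<partial>lborel \<partial>lborel \<partial>lborel)"
    by (intro nn_integral_cong nn_integral_lborel_translate) auto
  also have "\<dots> = (\<integral>\<^sup>+x. \<integral>\<^sup>+y. \<integral>\<^sup>+t. g (x, y, t) \<partial>lborel \<partial>lborel \<partial>lborel)"
    by (rule nn_integral_lborel_translate) auto
  also have "\<dots> = (\<integral>\<^sup>+\<xi>. g \<xi> \<partial>lborel)"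
    by (subst nn_integral_lborel_pair, simp, subst nn_integral_lborel_pair) auto
  finally show ?thesis .
qed

text \<open>A Lebesgue set differs from a Borel set by a subset of a Borel null set, so a Borel map
  pulls Lebesgue sets back to Lebesgue sets once preimages of Borel null sets are null. That
  condition is phrased as an integral so that Tonelli and left invariance can verify it.\<close>

lemma measurable_lebesgue_preimage_null:
  fixes T :: "'a::euclidean_space \<Rightarrow> 'b::euclidean_space"
  assumes T: "T \<in> borel_measurable borel"
    and null: "\<And>N. N \<in> sets borel \<Longrightarrow> emeasure lborel N = 0 \<Longrightarrow> (\<integral>\<^sup>+x. indicator N (T x) \<partial>lborel) = 0"
  shows "T \<in> lebesgue \<rightarrow>\<^sub>M lebesgue"
proof (rule completion.measurable_completion2)
  show T': "T \<in> lebesgue \<rightarrow>\<^sub>M lborel"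
    using T by (simp add: measurable_completion)
  show "null_sets lborel \<subseteq> null_sets (distr lebesgue lborel T)"
  proof
    fix N :: "'b set" assume N: "N \<in> null_sets lborel"
    then have N': "N \<in> sets borel" "emeasure lborel N = 0" by auto
    have "T -` N \<in> sets borel"
      using T N'(1) by (rule measurable_sets_borel)
    moreover have "(\<integral>\<^sup>+x. indicator (T -` N) x \<partial>lborel) = 0"
      using null[OF N'] by (simp add: indicator_vimage)
    ultimately show "N \<in> null_sets (distr lebesgue lborel T)"
      using N' T' by (simp add: null_sets_def emeasure_distr)
  qed
qed

section \<open>Projections and the group quotient as maps between Lebesgue spaces\<close>

lemma nn_integral_lborel_pair_swap:
  fixes g :: "'a::euclidean_space \<times> 'b::euclidean_space \<Rightarrow> ennreal"
  assumes "g \<in> borel_measurable borel"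
  shows "(\<integral>\<^sup>+x. g x \<partial>lborel) = (\<integral>\<^sup>+b. \<integral>\<^sup>+a. g (a, b) \<partial>lborel \<partial>lborel)"
  using lborel_pair.nn_integral_snd[of g] assms
  by (simp add: lborel_prod)

text \<open>Members of \<open>Z_space\<close> are only Lebesgue measurable, so composing them with a
  projection requires this stronger form. The preimage of a null set is a cylinder, which is null
  because integrating the first coordinate innermost already gives 0.\<close>

lemma fst_lebesgue: "fst \<in> (lebesgue :: ('a::euclidean_space \<times> 'b::euclidean_space) measure) \<rightarrow>\<^sub>M lebesgue"
proof (rule measurable_lebesgue_preimage_null)
  fix N :: "'a set" assume [measurable]: "N \<in> sets borel" and 0: "emeasure lborel N = 0"
  have "fst \<in> borel_measurable (borel :: ('a \<times> 'b) measure)"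
    by (intro borel_measurable_continuous_onI continuous_intros)
  then have "(\<lambda>p :: 'a \<times> 'b. indicator N (fst p) :: ennreal) \<in> borel_measurable borel"
    by (rule measurable_compose) simp
  then show "(\<integral>\<^sup>+(p :: 'a \<times> 'b). indicator N (fst p) \<partial>lborel) = 0"
    by (simp add: nn_integral_lborel_pair_swap 0)
qed (intro borel_measurable_continuous_onI continuous_intros)

lemma snd_lebesgue: "snd \<in> (lebesgue :: ('a::euclidean_space \<times> 'b::euclidean_space) measure) \<rightarrow>\<^sub>M lebesgue"
proof (rule measurable_lebesgue_preimage_null)
  fix N :: "'b set" assume [measurable]: "N \<in> sets borel" and 0: "emeasure lborel N = 0"
  have "snd \<in> borel_measurable (borel :: ('a \<times> 'b) measure)"
    by (intro borel_measurable_continuous_onI continuous_intros)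
  then have "(\<lambda>p :: 'a \<times> 'b. indicator N (snd p) :: ennreal) \<in> borel_measurable borel"
    by (rule measurable_compose) simp
  then show "(\<integral>\<^sup>+(p :: 'a \<times> 'b). indicator N (snd p) \<partial>lborel) = 0"
    by (simp add: nn_integral_lborel_pair 0)
qed (intro borel_measurable_continuous_onI continuous_intros)

text \<open>The argument of the kernel at the pair \<open>(\<xi>, \<eta>)\<close>, as a single map
  on the product space.\<close>

definition heis_quot :: "'n::finite heis \<times> 'n heis \<Rightarrow> 'n heis" where
  "heis_quot p = heis_mult (heis_inv (snd p)) (fst p)"

lemma heis_quot_borel [measurable]: "heis_quot \<in> borel_measurable borel"
  unfolding heis_quot_def heis_inv_eq
  by (intro borel_measurable_continuous_onI continuous_intros)

text \<open>Tonelli with \<open>\<eta>\<close> outermost: for fixed \<open>\<eta>\<close> the inner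
  integral is that of a left translate of \<open>g\<close>, so it does not depend on
  \<open>\<eta>\<close>. The formula serves both to show that preimages of null sets are null and to
  integrate the kernel over pairs.\<close>

lemma nn_integral_heis_quot:
  fixes g :: "'n::finite heis \<Rightarrow> ennreal" and h :: "'n heis \<Rightarrow> ennreal"
  assumes [measurable]: "g \<in> borel_measurable borel" "h \<in> borel_measurable borel"
  shows "(\<integral>\<^sup>+p. h (snd p) * g (heis_quot p) \<partial>lborel) = (\<integral>\<^sup>+\<xi>. h \<xi> \<partial>lborel) * (\<integral>\<^sup>+\<xi>. g \<xi> \<partial>lborel)"
proof -
  have "(\<integral>\<^sup>+p. h (snd p) * g (heis_quot p) \<partial>lborel) =
      (\<integral>\<^sup>+\<eta>. \<integral>\<^sup>+\<xi>. h \<eta> * g (heis_mult (heis_inv \<eta>) \<xi>) \<partial>lborel \<partial>lborel)"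
  proof -
    have "snd \<in> borel_measurable (borel :: ('n heis \<times> 'n heis) measure)"
      by (intro borel_measurable_continuous_onI continuous_intros)
    from measurable_compose[OF this assms(2)] measurable_compose[OF heis_quot_borel assms(1)]
    have "(\<lambda>p. h (snd p) * g (heis_quot p)) \<in> borel_measurable borel"
      by (rule borel_measurable_times_ennreal)
    then show ?thesis
      by (simp add: nn_integral_lborel_pair_swap heis_quot_def)
  qed
  also have "\<dots> = (\<integral>\<^sup>+\<eta>. h \<eta> * (\<integral>\<^sup>+\<xi>. g \<xi> \<partial>lborel) \<partial>lborel)"
  proof (rule nn_integral_cong)
    fix \<eta> :: "'n heis"
    have "(\<lambda>\<xi>. g (heis_mult (heis_inv \<eta>) \<xi>)) \<in> borel_measurable borel"
      by (intro measurable_compose[OF _ assms(1)] borel_measurable_continuous_onI continuous_intros)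
    then show "(\<integral>\<^sup>+\<xi>. h \<eta> * g (heis_mult (heis_inv \<eta>) \<xi>) \<partial>lborel) = h \<eta> * (\<integral>\<^sup>+\<xi>. g \<xi> \<partial>lborel)"
      by (subst nn_integral_cmult) (auto simp: nn_integral_heis_mult_left)
  qed
  also have "\<dots> = (\<integral>\<^sup>+\<xi>. h \<xi> \<partial>lborel) * (\<integral>\<^sup>+\<xi>. g \<xi> \<partial>lborel)"
    by (simp add: nn_integral_multc)
  finally show ?thesis .
qed

lemma heis_quot_lebesgue:
  "heis_quot \<in> (lebesgue :: ('n::finite heis \<times> 'n heis) measure) \<rightarrow>\<^sub>M lebesgue"
proof (rule measurable_lebesgue_preimage_null)
  fix N :: "'n heis set" assume [measurable]: "N \<in> sets borel" and 0: "emeasure lborel N = 0"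
  show "(\<integral>\<^sup>+p. indicator N (heis_quot p) \<partial>lborel) = 0"
    \<comment> \<open>The right-hand side is infinity times 0, which is 0 in
      \<open>ennreal\<close>.\<close>
    using nn_integral_heis_quot[of "indicator N" "\<lambda>_. 1"] by (simp add: 0)
qed simp

text \<open>The integral of the absolute value factors into the measure of \<open>A\<close> and the
  L1 norm of \<open>g\<close>. The factorisation holds for Borel functions, so \<open>g\<close> is
  first replaced by a Borel representative \<open>g'\<close>; the exceptional set \<open>N\<close>
  has a null preimage under \<open>heis_quot\<close>.\<close>

lemma integrable_heis_quot:
  fixes g :: "'n::finite heis \<Rightarrow> real"
  assumes "integrable lebesgue g" "A \<in> sets borel" "emeasure lborel A < \<infinity>"
  shows "integrable lebesgue (\<lambda>p. indicator A (snd p) * g (heis_quot p))"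
proof -
  note [measurable] = assms(2)
  have gm [measurable]: "g \<in> borel_measurable lebesgue" using assms(1) by auto
  obtain g' where g' [measurable]: "g' \<in> borel_measurable lborel" and ae: "AE x in lborel. g x = g' x"
    using completion_ex_borel_measurable_real[OF gm] by auto
  then obtain N where N: "{x. g x \<noteq> g' x} \<subseteq> N" "N \<in> null_sets lborel"
    by (auto elim!: AE_E simp: null_sets_def)
  then have [measurable]: "N \<in> sets borel" and N0: "emeasure lborel N = 0" by auto
  have "(\<integral>\<^sup>+p. 1 * indicator N (heis_quot p :: 'n heis) \<partial>lborel) = 0"
    by (subst nn_integral_heis_quot) (auto simp: N0)
  then have aeN: "AE p in lborel. heis_quot p \<notin> N"
    by (subst (asm) nn_integral_0_iff_AE) (auto simp: indicator_def)
  have "(\<lambda>p. indicator A (snd p) * g (heis_quot p)) \<in> borel_measurable lebesgue"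
    by (intro borel_measurable_times measurable_compose[OF heis_quot_lebesgue gm]
        measurable_compose[OF snd_lebesgue] borel_measurable_indicator) auto
  moreover have "(\<integral>\<^sup>+p. norm (indicator A (snd p) * g (heis_quot p)) \<partial>lebesgue) < \<infinity>"
  proof -
    have "(\<integral>\<^sup>+p. norm (indicator A (snd p) * g (heis_quot p)) \<partial>lebesgue) =
       (\<integral>\<^sup>+p. indicator A (snd p) * ennreal \<bar>g' (heis_quot p)\<bar> \<partial>lborel)"
      unfolding nn_integral_completion
      by (intro nn_integral_cong_AE, use aeN in eventually_elim)
         (use N(1) in \<open>force simp: indicator_def abs_mult\<close>)
    also have "\<dots> = emeasure lborel A * (\<integral>\<^sup>+x. ennreal \<bar>g' x\<bar> \<partial>lborel)"
      by (subst nn_integral_heis_quot) auto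
    also have "(\<integral>\<^sup>+x. ennreal \<bar>g' x\<bar> \<partial>lborel) = (\<integral>\<^sup>+x. ennreal \<bar>g x\<bar> \<partial>lebesgue)"
      unfolding nn_integral_completion using ae by (intro nn_integral_cong_AE) auto
    also have "emeasure lborel A * \<dots> < \<infinity>"
      using assms(1,3) by (auto simp: integrable_iff_bounded ennreal_mult_less_top)
    finally show ?thesis .
  qed
  ultimately show ?thesis by (simp add: integrable_iff_bounded)
qed

section \<open>Exchange of the two variables\<close>

lemma lebesgue_distr_swap:
  "distr lebesgue lebesgue (\<lambda>(x, y). (y, x)) = (lebesgue :: ('a::euclidean_space \<times> 'b::euclidean_space) measure)"
proof -
  let ?T = "(\<lambda>(x, y). (y, x)) :: 'b \<times> 'a \<Rightarrow> 'a \<times> 'b"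
  have b: "?T \<in> lborel \<rightarrow>\<^sub>M lborel"
    unfolding split_beta measurable_lborel1 measurable_lborel2
    by (intro borel_measurable_continuous_onI continuous_intros)
  have d: "distr lborel lborel ?T = lborel"
    using lborel_pair.distr_pair_swap[where ?'a='a and ?'b='b] by (simp add: lborel_prod del: distr_id2)
  have d': "distr lebesgue lborel ?T = lborel"
    by (simp add: distr_completion[OF b] d)
  have "completion (distr lebesgue lborel ?T) = distr lebesgue (completion lborel) ?T"
    by (rule completion.completion_distr_eq) (use b d' in \<open>auto simp: measurable_completion\<close>)
  then show ?thesis by (simp add: d')
qed

text \<open>Supplies the half of the dominating function for test functions in which the roles of
  \<open>\<xi>\<close> and \<open>\<eta>\<close> are exchanged.\<close>

lemma integrable_lebesgue_swap:
  fixes f :: "'a::euclidean_space \<times> 'b::euclidean_space \<Rightarrow> real"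
  assumes "integrable lebesgue f"
  shows "integrable lebesgue (\<lambda>p. f (snd p, fst p))"
proof -
  let ?T = "(\<lambda>(x, y). (y, x)) :: 'b \<times> 'a \<Rightarrow> 'a \<times> 'b"
  have T: "?T \<in> lebesgue \<rightarrow>\<^sub>M lebesgue"
  proof (rule measurable_lebesgue_preimage_null)
    show "?T \<in> borel_measurable borel"
      unfolding split_beta by (intro borel_measurable_continuous_onI continuous_intros)
    fix N :: "('a \<times> 'b) set" assume N: "N \<in> sets borel" "emeasure lborel N = 0"
    have "(\<lambda>x. indicator N (?T x) :: ennreal) \<in> borel_measurable borel"
      using N by (intro measurable_compose[OF \<open>?T \<in> borel_measurable borel\<close>]) simp
    then have "(\<integral>\<^sup>+x. indicator N (?T x) \<partial>lborel) =
        (\<integral>\<^sup>+b. \<integral>\<^sup>+a. indicator N (a, b) \<partial>lborel \<partial>lborel)"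
      by (simp add: nn_integral_lborel_pair)
    also have "\<dots> = (\<integral>\<^sup>+x. indicator N x \<partial>lborel)"
      using N by (subst nn_integral_lborel_pair_swap) auto
    finally have "(\<integral>\<^sup>+x. indicator N (?T x) \<partial>lborel) = (\<integral>\<^sup>+x. indicator N x \<partial>lborel)" .
    then show "(\<integral>\<^sup>+x. indicator N (?T x) \<partial>lborel) = 0"
      using N by simp
  qed
  have "integrable (distr lebesgue lebesgue ?T) f"
    using assms by (simp add: lebesgue_distr_swap)
  then show ?thesis
    by (subst (asm) integrable_distr_eq[OF T]) (use assms in \<open>auto simp: split_beta\<close>)
qed

subsection \<open>Square-integrable functions\<close>

text \<open>Dominated by the sum of the squares, through \<open>2 * \<bar>f x\<bar> * \<bar>g
  x\<bar> \<le> (f x)\<^sup>2 + (g x)\<^sup>2\<close>.\<close>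

lemma in_L2_mult_integrable:
  assumes "in_L2 A f" "in_L2 A g"
  shows "integrable (lebesgue_on A) (\<lambda>x. f x * g x)"
proof (rule Bochner_Integration.integrable_bound)
  show "integrable (lebesgue_on A) (\<lambda>x. (f x)\<^sup>2 + (g x)\<^sup>2)"
    using assms by (auto simp: in_L2_def)
  show "(\<lambda>x. f x * g x) \<in> borel_measurable (lebesgue_on A)"
    using assms by (auto simp: in_L2_def)
  show "AE x in lebesgue_on A. norm (f x * g x) \<le> norm ((f x)\<^sup>2 + (g x)\<^sup>2)"
  proof (rule AE_I2)
    fix x
    have "0 \<le> (\<bar>f x\<bar> - \<bar>g x\<bar>)\<^sup>2" by simp
    then have "2 * (\<bar>f x\<bar> * \<bar>g x\<bar>) \<le> (f x)\<^sup>2 + (g x)\<^sup>2"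
      by (simp add: power2_diff)
    moreover have "0 \<le> \<bar>f x\<bar> * \<bar>g x\<bar>" by simp
    ultimately show "norm (f x * g x) \<le> norm ((f x)\<^sup>2 + (g x)\<^sup>2)"
      unfolding real_norm_def abs_mult by linarith
  qed
qed

lemma in_L2_bound:
  assumes "in_L2 A g" "f \<in> borel_measurable (lebesgue_on A)" "\<And>x. \<bar>f x\<bar> \<le> \<bar>g x\<bar>"
  shows "in_L2 A f"
  unfolding in_L2_def
proof
  show "integrable (lebesgue_on A) (\<lambda>x. (f x)\<^sup>2)"
    by (rule Bochner_Integration.integrable_bound[of _ "\<lambda>x. (g x)\<^sup>2"])
       (use assms in \<open>auto simp: in_L2_def abs_le_square_iff\<close>)
qed (fact assms)

lemma in_L2_add:
  assumes "in_L2 A f" "in_L2 A g"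
  shows "in_L2 A (\<lambda>x. f x + g x)"
  using assms in_L2_mult_integrable[OF assms]
  by (auto simp: in_L2_def power2_sum mult.assoc)

lemma in_L2_cmult: "in_L2 A f \<Longrightarrow> in_L2 A (\<lambda>x. c * f x)"
  by (auto simp: in_L2_def power_mult_distrib)

lemma in_Linf_imp_in_L2:
  assumes "in_Linf A f" "A \<in> lmeasurable"
  shows "in_L2 A f"
proof -
  obtain C where C: "AE x in lebesgue_on A. \<bar>f x\<bar> \<le> C" and [measurable]: "f \<in> borel_measurable (lebesgue_on A)"
    using assms(1) by (auto simp: in_Linf_def)
  have "integrable (lebesgue_on A) (\<lambda>x. (f x)\<^sup>2)"
  proof (rule Bochner_Integration.integrable_bound)
    show "integrable (lebesgue_on A) (\<lambda>x. C\<^sup>2)"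
      using assms(2) by (intro finite_measure.integrable_const finite_measure_lebesgue_on)
    show "AE x in lebesgue_on A. norm ((f x)\<^sup>2) \<le> norm (C\<^sup>2)"
      using C by eventually_elim (simp add: abs_le_square_iff[symmetric])
  qed simp
  then show ?thesis by (simp add: in_L2_def)
qed

subsection \<open>The energy form\<close>

text \<open>Splitting the kernel into two square roots turns the energy into an L2 inner product of
  such functions over \<open>cross_set\<close>.\<close>

definition kernel_diff ::
  "('n::finite heis \<Rightarrow> real) \<Rightarrow> ('n heis \<Rightarrow> real) \<Rightarrow> 'n heis \<times> 'n heis \<Rightarrow> real" where
  "kernel_diff K u p = (u (fst p) - u (snd p)) * sqrt (K (heis_quot p))"

lemma Z_space_altdef:
  "u \<in> Z_space \<Omega> K \<longleftrightarrow>
     u \<in> borel_measurable lebesgue \<and> in_L2 \<Omega> u \<and> in_L2 (cross_set \<Omega>) (kernel_diff K u)"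
  by (simp add: Z_space_def kernel_diff_def[abs_def] heis_quot_def case_prod_unfold)

lemma heis_quot_eq_0_iff: "heis_quot (\<xi>, \<eta>) = 0 \<longleftrightarrow> \<xi> = \<eta>"
proof
  assume "heis_quot (\<xi>, \<eta>) = 0"
  then have "heis_mult \<eta> (heis_quot (\<xi>, \<eta>)) = \<eta>" by simp
  then show "\<xi> = \<eta>" by (simp add: heis_quot_def heis_mult_assoc[symmetric])
qed (simp add: heis_quot_def)

lemma heis_mult_heis_quot: "heis_mult \<eta> (heis_quot (\<xi>, \<eta>)) = \<xi>"
  by (simp add: heis_quot_def heis_mult_assoc[symmetric])

lemma heis_quot_swap: "heis_quot (\<eta>, \<xi>) = heis_inv (heis_quot (\<xi>, \<eta>))"
  by (cases \<xi>; cases \<eta>) (simp add: heis_quot_def inner_commute algebra_simps)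

text \<open>On the diagonal \<open>K 0\<close> may be negative, but both differences vanish there.
  Off the diagonal \<open>K\<close> is positive, so the two square roots multiply to
  \<open>K\<close>.\<close>

lemma kernel_diff_mult:
  assumes "kernel s K"
  shows "kernel_diff K u p * kernel_diff K v p = (u (fst p) - u (snd p)) * (v (fst p) - v (snd p)) * K (heis_quot p)"
proof (cases "fst p = snd p")
  case False
  then have "heis_quot p \<noteq> 0"
    using heis_quot_eq_0_iff[of "fst p" "snd p"] by simp
  then have "0 < K (heis_quot p)"
    using assms unfolding kernel_def by blast
  then show ?thesis
    by (simp add: kernel_diff_def algebra_simps flip: real_sqrt_mult)
qed (simp add: kernel_diff_def)

lemma energy_altdef:
  assumes "kernel s K"
  shows "energy \<Omega> K u v = (\<integral>p. kernel_diff K u p * kernel_diff K v p \<partial>lebesgue_on (cross_set \<Omega>))"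
  unfolding energy_def kernel_diff_mult[OF assms] by (simp add: case_prod_unfold heis_quot_def)

text \<open>A kernel is measurable only away from the origin; restoring its value at that single
  point gives a Lebesgue measurable function on the whole group, which can then be composed with
  \<open>heis_quot\<close>.\<close>

lemma measurable_kernel_diff:
  assumes "kernel s K" "u \<in> borel_measurable lebesgue"
  shows "kernel_diff K u \<in> borel_measurable lebesgue"
proof -
  have "(\<lambda>x. if x \<in> - {0} then K x else 0) \<in> borel_measurable lebesgue"
    using assms(1) by (intro borel_measurable_if_I) (auto simp: kernel_def)
  then have "(\<lambda>x. (if x \<in> - {0} then K x else 0) + K 0 * indicator {0} x) \<in> borel_measurable lebesgue"
    by (intro borel_measurable_add borel_measurable_times borel_measurable_indicator) auto
  also have "(\<lambda>x. (if x \<in> - {0} then K x else 0) + K 0 * indicator {0} x) = K"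
    by (auto simp: fun_eq_iff)
  finally have K: "K \<in> borel_measurable lebesgue" .
  note [measurable] = measurable_compose[OF fst_lebesgue assms(2)]
    measurable_compose[OF snd_lebesgue assms(2)] measurable_compose[OF heis_quot_lebesgue K]
  show ?thesis
    unfolding kernel_diff_def[abs_def] by measurable
qed

lemma kernel_diff_add: "kernel_diff K (\<lambda>\<xi>. u \<xi> + v \<xi>) p = kernel_diff K u p + kernel_diff K v p"
  by (simp add: kernel_diff_def algebra_simps)

lemma kernel_diff_cmult: "kernel_diff K (\<lambda>\<xi>. c * u \<xi>) p = c * kernel_diff K u p"
  by (simp add: kernel_diff_def algebra_simps)

lemma Z_space_add:
  "u \<in> Z_space \<Omega> K \<Longrightarrow> v \<in> Z_space \<Omega> K \<Longrightarrow> (\<lambda>\<xi>. u \<xi> + v \<xi>) \<in> Z_space \<Omega> K"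
  unfolding Z_space_altdef kernel_diff_add[abs_def]
  by (auto intro: in_L2_add simp: kernel_diff_add[abs_def])

lemma Z_space_cmult:
  "u \<in> Z_space \<Omega> K \<Longrightarrow> (\<lambda>\<xi>. c * u \<xi>) \<in> Z_space \<Omega> K"
  unfolding Z_space_altdef  by (auto intro: in_L2_cmult simp: kernel_diff_cmult[abs_def])

lemma Z_space_diff:
  assumes "u \<in> Z_space \<Omega> K" "v \<in> Z_space \<Omega> K"
  shows "(\<lambda>\<xi>. u \<xi> - v \<xi>) \<in> Z_space \<Omega> K"
  using Z_space_add[OF assms(1) Z_space_cmult[OF assms(2), of "-1"]] by simp

text \<open>Taking the positive part is 1-Lipschitz and fixes 0, so it increases neither absolute
  values nor increments.\<close>

lemma Z_space_max_0:
  assumes "kernel s K" "u \<in> Z_space \<Omega> K"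
  shows "(\<lambda>\<xi>. max (u \<xi>) 0) \<in> Z_space \<Omega> K"
proof -
  have u: "u \<in> borel_measurable lebesgue" "in_L2 \<Omega> u" "in_L2 (cross_set \<Omega>) (kernel_diff K u)"
    using assms(2) by (auto simp: Z_space_altdef)
  have m: "(\<lambda>\<xi>. max (u \<xi>) 0) \<in> borel_measurable lebesgue"
    using u(1) by measurable
  have "in_L2 \<Omega> (\<lambda>\<xi>. max (u \<xi>) 0)"
    by (rule in_L2_bound[OF u(2)]) (use m in \<open>auto intro: measurable_restrict_space1\<close>)
  moreover have "in_L2 (cross_set \<Omega>) (kernel_diff K (\<lambda>\<xi>. max (u \<xi>) 0))"
    using u(3)
  proof (rule in_L2_bound)
    show "kernel_diff K (\<lambda>\<xi>. max (u \<xi>) 0) \<in> borel_measurable (lebesgue_on (cross_set \<Omega>))"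
      by (intro measurable_restrict_space1 measurable_kernel_diff[OF assms(1) m])
    show "\<bar>kernel_diff K (\<lambda>\<xi>. max (u \<xi>) 0) p\<bar> \<le> \<bar>kernel_diff K u p\<bar>" for p
      unfolding kernel_diff_def abs_mult by (intro mult_right_mono) auto
  qed
  ultimately show ?thesis using m by (simp add: Z_space_altdef)
qed

lemma kernel_diff_integrable:
  "u \<in> Z_space \<Omega> K \<Longrightarrow> v \<in> Z_space \<Omega> K \<Longrightarrow>
    integrable (lebesgue_on (cross_set \<Omega>)) (\<lambda>p. kernel_diff K u p * kernel_diff K v p)"
  by (auto simp: Z_space_altdef intro: in_L2_mult_integrable)

lemma energy_add_right:
  assumes "kernel s K" "u \<in> Z_space \<Omega> K" "v \<in> Z_space \<Omega> K" "w \<in> Z_space \<Omega> K"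
  shows "energy \<Omega> K u (\<lambda>\<xi>. v \<xi> + w \<xi>) = energy \<Omega> K u v + energy \<Omega> K u w"
  using kernel_diff_integrable[OF assms(2,3)] kernel_diff_integrable[OF assms(2,4)]
  by (simp add: energy_altdef[OF assms(1)] kernel_diff_add algebra_simps)

lemma energy_cmult_right:
  assumes "kernel s K"
  shows "energy \<Omega> K u (\<lambda>\<xi>. c * v \<xi>) = c * energy \<Omega> K u v"
  by (simp add: energy_altdef[OF assms] kernel_diff_cmult mult.left_commute)

subsection \<open>Test functions have finite energy\<close>

text \<open>\<open>C_k\<close> provides continuity of the derivative one direction at a time. Each
  basis direction is bounded on the compact ball, the sum of these bounds controls the operator
  norm, and the mean value inequality applies because the ball is convex.\<close>

lemma C_k_1_lipschitz_on_cball: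
  fixes \<psi> :: "'a::euclidean_space \<Rightarrow> real"
  assumes "C_k (Suc 0) \<psi>"
  obtains L where "0 \<le> L" "\<And>x y. x \<in> cball 0 R \<Longrightarrow> y \<in> cball 0 R \<Longrightarrow> \<bar>\<psi> x - \<psi> y\<bar> \<le> L * norm (x - y)"
proof -
  let ?D = "\<lambda>x. frechet_derivative \<psi> (at x)"
  have der: "(\<psi> has_derivative ?D x) (at x)" for x
    using assms by (simp add: frechet_derivative_works)
  have "bounded ((\<lambda>x. ?D x b) ` cball 0 R)" for b
    using assms
    by (intro compact_imp_bounded compact_continuous_image) (auto intro: continuous_on_subset)
  then have "\<exists>B. \<forall>x\<in>cball 0 R. \<bar>?D x b\<bar> \<le> B" for b
    unfolding bounded_iff by auto
  then obtain B where B: "\<And>b x. x \<in> cball 0 R \<Longrightarrow> \<bar>?D x b\<bar> \<le> B b"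
    by metis
  define L where "L = (\<Sum>b\<in>Basis. \<bar>B b\<bar>)"
  have onorm: "onorm (?D x) \<le> L" if x: "x \<in> cball 0 R" for x
  proof (rule onorm_bound)
    show "0 \<le> L" by (simp add: L_def sum_nonneg)
    fix v
    have lin: "linear (?D x)" using der has_derivative_linear by blast
    have "?D x v = ?D x (\<Sum>b\<in>Basis. (v \<bullet> b) *\<^sub>R b)" by (simp add: euclidean_representation)
    also have "\<dots> = (\<Sum>b\<in>Basis. (v \<bullet> b) * ?D x b)"
      by (simp add: linear_sum[OF lin] linear_cmul[OF lin])
    also have "\<bar>\<dots>\<bar> \<le> (\<Sum>b\<in>Basis. norm v * \<bar>B b\<bar>)"
      by (rule order_trans[OF sum_abs], rule sum_mono, unfold abs_mult, rule mult_mono)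
         (use B[OF x] in \<open>auto simp: Basis_le_norm intro: order_trans[OF _ abs_ge_self]\<close>)
    finally show "norm (?D x v) \<le> L * norm v"
      by (simp add: L_def sum_distrib_left mult.commute)
  qed
  show thesis
  proof (rule that[of L])
    show "0 \<le> L" by (simp add: L_def sum_nonneg)
    show "\<bar>\<psi> x - \<psi> y\<bar> \<le> L * norm (x - y)" if "x \<in> cball 0 R" "y \<in> cball 0 R" for x y
      using differentiable_bound[OF convex_cball has_derivative_at_withinI[OF der] onorm that] by simp
  qed
qed

section \<open>The homogeneous norm compared with Euclidean lengths\<close>

lemma heis_norm_nonneg: "0 \<le> heis_norm \<zeta>"
  by (simp add: heis_norm_eq)

lemma heis_norm_power4:
  "heis_norm \<zeta> ^ 4 = (snd (snd \<zeta>))\<^sup>2 + ((norm (fst \<zeta>))\<^sup>2 + (norm (fst (snd \<zeta>)))\<^sup>2)\<^sup>2"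
proof -
  have "(x powr (1/4)) ^ 4 = x" if "0 \<le> x" for x :: real
    using that powr_realpow'[of "x powr (1/4)" 4] by (simp add: powr_powr)
  then show ?thesis by (simp add: heis_norm_eq)
qed

lemma heis_norm_inv: "heis_norm (heis_inv \<zeta>) = heis_norm \<zeta>"
  by (simp add: heis_norm_eq heis_inv_eq)

text \<open>Each bound drops the other nonnegative terms from the fourth power of the homogeneous
  norm. The vertical coordinate has homogeneous degree two, hence the square.\<close>

lemma components_le_heis_norm:
  shows "norm (fst \<zeta>) \<le> heis_norm \<zeta>" "norm (fst (snd \<zeta>)) \<le> heis_norm \<zeta>"
    and "\<bar>snd (snd \<zeta>)\<bar> \<le> (heis_norm \<zeta>)\<^sup>2"
proof -
  let ?a = "norm (fst \<zeta>)" and ?b = "norm (fst (snd \<zeta>))" and ?c = "snd (snd \<zeta>)"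
  have 1: "(?a\<^sup>2)\<^sup>2 \<le> (?a\<^sup>2 + ?b\<^sup>2)\<^sup>2" "(?b\<^sup>2)\<^sup>2 \<le> (?a\<^sup>2 + ?b\<^sup>2)\<^sup>2"
    by (intro power_mono; simp)+
  have "?a ^ 4 \<le> heis_norm \<zeta> ^ 4" "?b ^ 4 \<le> heis_norm \<zeta> ^ 4"
    using 1 zero_le_power2[of ?c] unfolding heis_norm_power4 power_mult[symmetric]
    by (simp_all only: mult_2 numeral_Bit0[symmetric] numeral_One; linarith)+
  then show "?a \<le> heis_norm \<zeta>" "?b \<le> heis_norm \<zeta>"
    by (auto simp: heis_norm_nonneg)
  have "\<bar>?c\<bar>\<^sup>2 \<le> ((heis_norm \<zeta>)\<^sup>2)\<^sup>2"
    using heis_norm_power4[of \<zeta>] by (simp add: power_mult[symmetric])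
  then show "\<bar>?c\<bar> \<le> (heis_norm \<zeta>)\<^sup>2"
    by (rule power2_le_imp_le) simp
qed

text \<open>The displacement is \<open>(a, b, c + 2 * (a \<bullet> y - x \<bullet> b))\<close>. The
  three coordinates of \<open>\<zeta>\<close> give the 3, with \<open>\<bar>c\<bar>\<close> at most
  the square of a norm not exceeding 1; the two inner products, doubled, give
  \<open>4 * R\<close>.\<close>

lemma norm_heis_mult_diff_le:
  assumes "norm \<eta> \<le> R" "heis_norm \<zeta> \<le> 1"
  shows "norm (heis_mult \<eta> \<zeta> - \<eta>) \<le> (3 + 4 * R) * heis_norm \<zeta>"
proof -
  let ?h = "heis_norm \<zeta>"
  obtain x y t a b c where \<eta>: "\<eta> = (x, y, t)" and \<zeta>: "\<zeta> = (a, b, c)"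
    by (cases \<eta>; cases \<zeta>)
  have h: "norm a \<le> ?h" "norm b \<le> ?h" "\<bar>c\<bar> \<le> ?h\<^sup>2"
    using components_le_heis_norm[of \<zeta>] by (auto simp: \<zeta> simp del: heis_norm.simps)
  have h2: "?h\<^sup>2 \<le> ?h"
    using assms(2) heis_norm_nonneg[of \<zeta>] by (simp add: power2_eq_square mult_left_le)
  have xy: "norm x \<le> R" "norm y \<le> R"
    using assms(1) norm_fst_le[of x "(y, t)"] norm_snd_le[of "(y, t)" x] norm_fst_le[of y t]
    by (auto simp: \<eta>)
  have "\<bar>a \<bullet> y\<bar> \<le> ?h * R" "\<bar>x \<bullet> b\<bar> \<le> R * ?h"
    using h xy heis_norm_nonneg[of \<zeta>] norm_ge_zero[of x]
    by (intro order_trans[OF Cauchy_Schwarz_ineq2] mult_mono; linarith?; simp)+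
  then have t: "\<bar>c + 2 * (a \<bullet> y - x \<bullet> b)\<bar> \<le> ?h + 4 * (R * ?h)"
    using h(3) h2 by (simp add: mult.commute abs_le_iff)
  have "norm (heis_mult \<eta> \<zeta> - \<eta>) = norm (a, b, c + 2 * (a \<bullet> y - x \<bullet> b))"
    by (simp add: \<eta> \<zeta>)
  also have "\<dots> \<le> norm a + (norm b + \<bar>c + 2 * (a \<bullet> y - x \<bullet> b)\<bar>)"
    by (rule order_trans[OF norm_Pair_le add_left_mono]) (use norm_Pair_le[of b "c + 2 * (a \<bullet> y - x \<bullet> b)"] in simp)
  also have "\<dots> \<le> ?h + (?h + (?h + 4 * (R * ?h)))"
    using h t by linarith
  finally show ?thesis by (simp add: algebra_simps)
qed

text \<open>At quotient norm at most 1 the Lipschitz bound gives the square of the homogeneous norm;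
  beyond that, boundedness of \<open>\<psi>\<close> suffices.\<close>

lemma test_function_increment_bound:
  fixes \<psi> :: "'n::finite heis \<Rightarrow> real"
  assumes "C_k (Suc 0) \<psi>" "bounded \<Omega>" "\<And>\<xi>. \<xi> \<notin> \<Omega> \<Longrightarrow> \<psi> \<xi> = 0"
  obtains C where "0 \<le> C"
    "\<And>\<xi> \<eta>. \<xi> \<in> \<Omega> \<or> \<eta> \<in> \<Omega> \<Longrightarrow>
      (\<psi> \<xi> - \<psi> \<eta>)\<^sup>2 \<le> C * min 1 ((heis_norm (heis_quot (\<xi>, \<eta>)))\<^sup>2)"
proof -
  obtain R where R: "0 < R" "\<And>\<xi>. \<xi> \<in> \<Omega> \<Longrightarrow> norm \<xi> \<le> R"
    using assms(2) bounded_pos by blast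
  \<comment> \<open>Moving a point of \<open>\<Omega>\<close> by a group element of norm at most 1
    changes it by at most \<open>?k\<close> in Euclidean norm, so both points stay in the ball of
    radius \<open>R + ?k\<close>.\<close>
  let ?k = "3 + 4 * R"
  obtain L where L: "0 \<le> L"
    "\<And>x y. x \<in> cball 0 (R + ?k) \<Longrightarrow> y \<in> cball 0 (R + ?k) \<Longrightarrow> \<bar>\<psi> x - \<psi> y\<bar> \<le> L * norm (x - y)"
    by (rule C_k_1_lipschitz_on_cball[OF assms(1), of "R + ?k"]) blast
  have "continuous_on UNIV \<psi>"
    using assms(1) by (intro differentiable_imp_continuous_on) (auto simp: differentiable_on_def differentiable_at_withinI)
  then have "bounded (\<psi> ` cball 0 R)"
    by (intro compact_imp_bounded compact_continuous_image) (auto intro: continuous_on_subset)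
  then obtain B where B: "0 < B" "\<And>\<xi>. \<xi> \<in> cball 0 R \<Longrightarrow> \<bar>\<psi> \<xi>\<bar> \<le> B"
    unfolding bounded_pos by auto
  have B': "\<bar>\<psi> \<xi>\<bar> \<le> B" for \<xi>
    using B(1) B(2)[of \<xi>] R(2)[of \<xi>] assms(3)[of \<xi>] by (cases "\<xi> \<in> \<Omega>") auto
  have near: "\<bar>\<psi> (heis_mult \<eta> \<zeta>) - \<psi> \<eta>\<bar> \<le> L * ?k * heis_norm \<zeta>"
    if "\<eta> \<in> \<Omega>" "heis_norm \<zeta> \<le> 1" for \<eta> \<zeta>
  proof -
    have d: "norm (heis_mult \<eta> \<zeta> - \<eta>) \<le> ?k * heis_norm \<zeta>"
      by (rule norm_heis_mult_diff_le) (use that R in auto)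
    also have "\<dots> \<le> ?k" using that(2) R(1) by (simp add: mult_left_le)
    finally have "norm (heis_mult \<eta> \<zeta>) \<le> R + ?k"
      using norm_triangle_ineq[of "heis_mult \<eta> \<zeta> - \<eta>" \<eta>] R(2)[OF that(1)] by simp
    then have "\<bar>\<psi> (heis_mult \<eta> \<zeta>) - \<psi> \<eta>\<bar> \<le> L * norm (heis_mult \<eta> \<zeta> - \<eta>)"
      using R(1) R(2)[OF that(1)] by (intro L(2)) auto
    also have "\<dots> \<le> L * (?k * heis_norm \<zeta>)" by (intro mult_left_mono d L)
    finally show ?thesis by (simp add: mult.assoc)
  qed
  define C where "C = max ((L * ?k)\<^sup>2) ((2 * B)\<^sup>2)"
  show thesis
  proof (rule that[of C])
    show "0 \<le> C" by (simp add: C_def le_max_iff_disj)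
    fix \<xi> \<eta> assume *: "\<xi> \<in> \<Omega> \<or> \<eta> \<in> \<Omega>"
    let ?h = "heis_norm (heis_quot (\<xi>, \<eta>))"
    show "(\<psi> \<xi> - \<psi> \<eta>)\<^sup>2 \<le> C * min 1 (?h\<^sup>2)"
    proof (cases "?h \<le> 1")
      case True
      have "\<bar>\<psi> \<xi> - \<psi> \<eta>\<bar> \<le> L * ?k * ?h"
      proof (cases "\<eta> \<in> \<Omega>")
        case True
        then show ?thesis
          using near[of \<eta> "heis_quot (\<xi>, \<eta>)"] \<open>?h \<le> 1\<close> by (simp add: heis_mult_heis_quot)
      next
        \<comment> \<open>Now \<open>\<xi>\<close> is the base point in \<open>\<Omega>\<close>; the
          reversed quotient is the inverse and has the same norm.\<close>
        case False
        have "heis_norm (heis_quot (\<eta>, \<xi>)) = ?h"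
          by (simp only: heis_quot_swap[of \<eta> \<xi>] heis_norm_inv)
        then show ?thesis
          using near[of \<xi> "heis_quot (\<eta>, \<xi>)"] \<open>?h \<le> 1\<close> False *
          by (simp add: heis_mult_heis_quot abs_minus_commute)
      qed
      then have "(\<psi> \<xi> - \<psi> \<eta>)\<^sup>2 \<le> (L * ?k * ?h)\<^sup>2"
        using L(1) R(1) heis_norm_nonneg[of "heis_quot (\<xi>, \<eta>)"]
        by (intro power2_le_iff_abs_le[THEN iffD2] mult_nonneg_nonneg) auto
      also have "\<dots> = (L * ?k)\<^sup>2 * ?h\<^sup>2" by (simp add: power_mult_distrib)
      also have "\<dots> \<le> C * ?h\<^sup>2" by (intro mult_right_mono) (auto simp: C_def)
      also have "?h\<^sup>2 = min 1 (?h\<^sup>2)"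
        using power_le_one[OF heis_norm_nonneg True, of 2] by (simp add: min_def)
      finally show ?thesis .
    next
      case False
      have "\<bar>\<psi> \<xi> - \<psi> \<eta>\<bar> \<le> 2 * B" using B'[of \<xi>] B'[of \<eta>] by linarith
      then have "(\<psi> \<xi> - \<psi> \<eta>)\<^sup>2 \<le> (2 * B)\<^sup>2"
        using B(1) by (intro power2_le_iff_abs_le[THEN iffD2]) auto
      also have "\<dots> \<le> C" by (simp add: C_def)
      also have "C = C * min 1 (?h\<^sup>2)"
        using False one_le_power[of ?h 2] by (simp add: min_def)
      finally show ?thesis .
    qed
  qed
qed

text \<open>On \<open>cross_set\<close> at least one of the two points lies in
  \<open>\<Omega>\<close>, a set of finite measure. The squared increment times the kernel is thus
  dominated by a function supported on \<open>\<eta> \<in> \<Omega>\<close> plus its mirror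
  image.\<close>

lemma Cc_infinity_in_Z0_space:
  fixes \<psi> :: "'n::finite heis \<Rightarrow> real"
  assumes K: "kernel s K" and "open \<Omega>" "bounded \<Omega>" and \<psi>: "\<psi> \<in> Cc_infinity \<Omega>"
  shows "\<psi> \<in> Z0_space \<Omega> K"
proof -
  have C1: "C_k (Suc 0) \<psi>" and cont: "continuous_on UNIV \<psi>"
    using \<psi> C_k.simps(1)[of \<psi>] unfolding Cc_infinity_def by blast+
  have outside: "\<psi> \<xi> = 0" if "\<xi> \<notin> \<Omega>" for \<xi>
    using \<psi> that closure_subset[of "{x. \<psi> x \<noteq> 0}"] unfolding Cc_infinity_def by blast
  have \<Omega>: "\<Omega> \<in> sets borel" "\<Omega> \<in> lmeasurable" "emeasure lborel \<Omega> < \<infinity>"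
    using assms(2,3) emeasure_bounded_finite[OF assms(3)] by (auto simp: lmeasurable_open)
  have meas: "\<psi> \<in> borel_measurable lebesgue"
    using cont by (simp add: borel_measurable_continuous_onI measurable_completion)
  obtain C where C: "0 \<le> C" "\<And>\<xi> \<eta>. \<xi> \<in> \<Omega> \<or> \<eta> \<in> \<Omega> \<Longrightarrow>
      (\<psi> \<xi> - \<psi> \<eta>)\<^sup>2 \<le> C * min 1 ((heis_norm (heis_quot (\<xi>, \<eta>)))\<^sup>2)"
    using test_function_increment_bound[OF C1 assms(3) outside] by blast
  obtain B where B: "\<And>\<xi>. \<bar>\<psi> \<xi>\<bar> \<le> B"
  proof -
    have "bounded (\<psi> ` closure \<Omega>)"
      using cont assms(3)
      by (intro compact_imp_bounded compact_continuous_image) (auto intro: continuous_on_subset)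
    then obtain B where B: "0 < B" "\<And>\<xi>. \<xi> \<in> closure \<Omega> \<Longrightarrow> \<bar>\<psi> \<xi>\<bar> \<le> B"
      unfolding bounded_pos by auto
    have "\<bar>\<psi> \<xi>\<bar> \<le> B" for \<xi>
      using B(1) B(2)[of \<xi>] outside[of \<xi>] closure_subset[of \<Omega>] by (cases "\<xi> \<in> \<Omega>") auto
    then show thesis by (rule that)
  qed
  have "AE \<xi> in lebesgue_on \<Omega>. \<bar>\<psi> \<xi>\<bar> \<le> B"
    by (rule AE_I2) (rule B)
  then have "in_Linf \<Omega> \<psi>"
    using meas unfolding in_Linf_def by (blast intro: measurable_restrict_space1)
  then have L2: "in_L2 \<Omega> \<psi>"
    using \<Omega>(2) by (rule in_Linf_imp_in_L2)
  \<comment> \<open>The value at the origin is fixed as 0 because \<open>K 0\<close> is arbitrary;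
    this keeps \<open>g\<close> nonnegative everywhere.\<close>
  define g where "g \<zeta> = (if \<zeta> \<in> - {0} then min 1 ((heis_norm \<zeta>)\<^sup>2) * K \<zeta> else 0)" for \<zeta>
  have g: "integrable lebesgue g"
  proof -
    have "integrable lebesgue (\<lambda>\<zeta>. indicator (- {0}) \<zeta> *\<^sub>R (min 1 ((heis_norm \<zeta>)\<^sup>2) * K \<zeta>))"
      using K unfolding kernel_def by (subst integrable_restrict_space[symmetric]) auto
    also have "(\<lambda>\<zeta>. indicator (- {0}) \<zeta> *\<^sub>R (min 1 ((heis_norm \<zeta>)\<^sup>2) * K \<zeta>)) = g"
      by (auto simp: g_def fun_eq_iff)
    finally show ?thesis .
  qed
  have Kpos: "0 < K \<zeta>" "K \<zeta> = K (heis_inv \<zeta>)" if "\<zeta> \<noteq> 0" for \<zeta>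
    using K that unfolding kernel_def by blast+
  have g_nonneg: "0 \<le> g \<zeta>" for \<zeta>
    using Kpos[of \<zeta>] by (auto simp: g_def)
  have g_swap: "g (heis_quot (\<eta>, \<xi>)) = g (heis_quot (\<xi>, \<eta>))" for \<xi> \<eta>
  proof (cases "\<xi> = \<eta>")
    case False
    then have nz: "heis_quot (\<xi>, \<eta>) \<noteq> 0" "heis_inv (heis_quot (\<xi>, \<eta>)) \<noteq> 0"
      using heis_quot_eq_0_iff[of \<xi> \<eta>] heis_quot_eq_0_iff[of \<eta> \<xi>]
      by (simp_all add: heis_quot_swap[of \<eta> \<xi>])
    have "g (heis_inv (heis_quot (\<xi>, \<eta>))) = g (heis_quot (\<xi>, \<eta>))"
      using nz Kpos(2)[OF nz(1)] by (simp only: g_def heis_norm_inv Compl_iff singleton_iff)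
    then show ?thesis
      by (simp only: heis_quot_swap[of \<eta> \<xi>])
  qed simp
  let ?G = "\<lambda>p. indicator \<Omega> (snd p) * g (heis_quot p)"
  have G: "integrable lebesgue ?G"
    using g \<Omega>(1,3) by (rule integrable_heis_quot)
  have "integrable (lebesgue_on (cross_set \<Omega>)) (\<lambda>p. (kernel_diff K \<psi> p)\<^sup>2)"
  proof (rule Bochner_Integration.integrable_bound)
    have "open (cross_set \<Omega>)"
      using assms(2) unfolding cross_set_def by (intro open_Diff closed_Times) auto
    then have "cross_set \<Omega> \<in> sets lebesgue" by auto
    then have restrict: "integrable (lebesgue_on (cross_set \<Omega>)) h" if "integrable lebesgue h" for h :: "_ \<Rightarrow> real"
      using integrable_mult_indicator[OF _ that] by (subst integrable_restrict_space) auto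
    show "integrable (lebesgue_on (cross_set \<Omega>)) (\<lambda>p. C * (?G p + ?G (snd p, fst p)))"
      by (intro restrict integrable_mult_right Bochner_Integration.integrable_add G
          integrable_lebesgue_swap[OF G])
    show "(\<lambda>p. (kernel_diff K \<psi> p)\<^sup>2) \<in> borel_measurable (lebesgue_on (cross_set \<Omega>))"
      using measurable_kernel_diff[OF K meas] by (auto intro: measurable_restrict_space1)
    show "AE p in lebesgue_on (cross_set \<Omega>). norm ((kernel_diff K \<psi> p)\<^sup>2) \<le> norm (C * (?G p + ?G (snd p, fst p)))"
    proof (rule AE_I2)
      fix p assume "p \<in> space (lebesgue_on (cross_set \<Omega>))"
      then have p: "fst p \<in> \<Omega> \<or> snd p \<in> \<Omega>" by (auto simp: cross_set_def mem_Times_iff)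
      have "(kernel_diff K \<psi> p)\<^sup>2 = (\<psi> (fst p) - \<psi> (snd p))\<^sup>2 * K (heis_quot p)"
        using kernel_diff_mult[OF K, of \<psi> p \<psi>] by (simp add: power2_eq_square)
      also have "\<dots> \<le> C * g (heis_quot p)"
      proof (cases "fst p = snd p")
        case False
        then have "heis_quot p \<noteq> 0" using heis_quot_eq_0_iff[of "fst p" "snd p"] by simp
        then show ?thesis
          using mult_right_mono[OF C(2)[OF p], of "K (heis_quot p)"] Kpos[of "heis_quot p"]
          by (simp add: g_def mult.assoc)
      qed (simp add: C g_nonneg)
      \<comment> \<open>At least one of the two indicators equals 1, and \<open>g_swap\<close>
        identifies the two values of \<open>g\<close>.\<close>
      also have "\<dots> \<le> C * (?G p + ?G (snd p, fst p))"
        using p g_nonneg g_swap[of "snd p" "fst p"] by (intro mult_left_mono C) (auto simp: indicator_def)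
      finally show "norm ((kernel_diff K \<psi> p)\<^sup>2) \<le> norm (C * (?G p + ?G (snd p, fst p)))"
        by simp
    qed
  qed
  then have "in_L2 (cross_set \<Omega>) (kernel_diff K \<psi>)"
    using measurable_kernel_diff[OF K meas] by (simp add: in_L2_def measurable_restrict_space1)
  moreover have "AE \<xi> in lebesgue_on (- \<Omega>). \<psi> \<xi> = 0"
    by (rule AE_I2) (simp add: outside)
  ultimately show ?thesis
    using meas L2 by (simp add: Z0_space_def Z_space_altdef)
qed

subsection \<open>The Lewy--Stampacchia inequality\<close>

text \<open>With \<open>z = u + t\<psi>\<close>, \<open>p = (z - \<phi>)\<^sup>+\<close> and \<open>n = (\<phi> - z)\<^sup>+\<close> we have
  \<open>u = \<phi> - n + p - t\<psi>\<close>. The term with \<open>n\<close> has a sign because \<open>n\<close> and \<open>p\<close> are nonnegative with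
  disjoint supports, and the last two terms are handled by completing the square.\<close>

lemma energy_truncation_ge:
  fixes t :: real
  assumes K: "kernel s K" and Z: "u \<in> Z_space \<Omega> K" "\<phi> \<in> Z_space \<Omega> K" "\<psi> \<in> Z_space \<Omega> K"
  defines "p \<equiv> \<lambda>\<xi>. max (u \<xi> + t * \<psi> \<xi> - \<phi> \<xi>) 0"
  shows "energy \<Omega> K \<phi> p - t\<^sup>2 / 4 * energy \<Omega> K \<psi> \<psi> \<le> energy \<Omega> K u p"
proof -
  let ?D = "kernel_diff K"
  have p: "p \<in> Z_space \<Omega> K"
    unfolding p_def by (intro Z_space_max_0[OF K] Z_space_diff Z_space_add Z_space_cmult Z)
  have pw: "?D \<phi> q * ?D p q - t\<^sup>2 / 4 * (?D \<psi> q * ?D \<psi> q) \<le> ?D u q * ?D p q" for q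
  proof -
    define n where "n \<xi> = max (\<phi> \<xi> - (u \<xi> + t * \<psi> \<xi>)) 0" for \<xi>
    have u: "u \<xi> = \<phi> \<xi> - n \<xi> + p \<xi> - t * \<psi> \<xi>" for \<xi>
      by (auto simp: n_def p_def max_def)
    have Du: "?D u q = ?D \<phi> q - ?D n q + ?D p q - t * ?D \<psi> q"
      unfolding kernel_diff_def u by (simp add: algebra_simps)
    have np: "n \<xi> * p \<xi> = 0" "0 \<le> n \<xi>" "0 \<le> p \<xi>" for \<xi>
      by (auto simp: n_def p_def max_def)
    \<comment> \<open>Since \<open>n\<close> and \<open>p\<close> have product 0 at each point, only
      the two mixed terms survive, both with a minus sign.\<close>
    have "(n \<xi> - n \<eta>) * (p \<xi> - p \<eta>) \<le> 0" for \<xi> \<eta>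
      using np[of \<xi>] np[of \<eta>] mult_nonneg_nonneg[of "n \<xi>" "p \<eta>"] mult_nonneg_nonneg[of "n \<eta>" "p \<xi>"]
      unfolding left_diff_distrib right_diff_distrib by linarith
    from this[of "fst q" "snd q"]
    have "(n (fst q) - n (snd q)) * (p (fst q) - p (snd q)) * (sqrt (K (heis_quot q)))\<^sup>2 \<le> 0"
      by (rule mult_nonpos_nonneg) simp
    then have "?D n q * ?D p q \<le> 0"
      by (simp only: kernel_diff_def power2_eq_square mult_ac)
    \<comment> \<open>This square absorbs the terms
      \<open>?D p q * ?D p q - t * ?D \<psi> q * ?D p q\<close> that come from \<open>Du\<close>, at
      the cost of the \<open>t\<^sup>2 / 4\<close> error.\<close>
    moreover have "0 \<le> (?D p q - t / 2 * ?D \<psi> q)\<^sup>2" by simp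
    ultimately show ?thesis
      unfolding Du by (simp add: algebra_simps power2_eq_square)
  qed
  have int: "integrable (lebesgue_on (cross_set \<Omega>)) (\<lambda>q. ?D \<phi> q * ?D p q)"
    "integrable (lebesgue_on (cross_set \<Omega>)) (\<lambda>q. ?D u q * ?D p q)"
    "integrable (lebesgue_on (cross_set \<Omega>)) (\<lambda>q. ?D \<psi> q * ?D \<psi> q)"
    by (intro kernel_diff_integrable Z p)+
  have "energy \<Omega> K \<phi> p - t\<^sup>2 / 4 * energy \<Omega> K \<psi> \<psi> =
      (\<integral>q. ?D \<phi> q * ?D p q - t\<^sup>2 / 4 * (?D \<psi> q * ?D \<psi> q) \<partial>lebesgue_on (cross_set \<Omega>))"
    using int by (simp add: energy_altdef[OF K])
  also have "\<dots> \<le> energy \<Omega> K u p"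
    unfolding energy_altdef[OF K] by (rule integral_mono) (use int pw in auto)
  finally show ?thesis .
qed

theorem theorem1p1:
  fixes s :: real
    and K :: "'n::finite heis \<Rightarrow> real"
    and \<Omega> :: "'n heis set"
    and f u0 \<phi> L\<phi> u :: "'n heis \<Rightarrow> real"
  assumes "0 < s" "s < 1"
    and "kernel s K"
    and "bounded \<Omega>" "extension_domain s \<Omega>"
    and "in_Linf \<Omega> f"
    and "u0 \<in> Z_space \<Omega> K" "in_Linf (- \<Omega>) u0"
    and "\<phi> \<in> Z_space \<Omega> K" "AE \<xi> in lebesgue. u0 \<xi> \<le> \<phi> \<xi>"
    and "has_L_op \<Omega> K \<phi> L\<phi>"
    and "u \<in> obstacle_set \<Omega> K u0 \<phi>"
    and "\<forall>v \<in> obstacle_set \<Omega> K u0 \<phi>.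
           energy \<Omega> K u (\<lambda>\<xi>. v \<xi> - u \<xi>) \<ge> (\<integral>\<xi>. f \<xi> * (v \<xi> - u \<xi>) \<partial>lebesgue_on \<Omega>)"
  shows "\<forall>\<psi> \<in> Cc_infinity \<Omega>. (\<forall>\<xi>. 0 \<le> \<psi> \<xi>) \<longrightarrow>
           0 \<le> - energy \<Omega> K u \<psi> + (\<integral>\<xi>. f \<xi> * \<psi> \<xi> \<partial>lebesgue_on \<Omega>) \<and>
           - energy \<Omega> K u \<psi> + (\<integral>\<xi>. f \<xi> * \<psi> \<xi> \<partial>lebesgue_on \<Omega>)
             \<le> (\<integral>\<xi>. max (L\<phi> \<xi> + f \<xi>) 0 * \<psi> \<xi> \<partial>lebesgue_on \<Omega>)"
proof (intro ballI impI)
  fix \<psi> assume \<psi>: "\<psi> \<in> Cc_infinity \<Omega>" and "\<forall>\<xi>. 0 \<le> \<psi> \<xi>"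
  then have \<psi>0: "0 \<le> \<psi> \<xi>" for \<xi> by blast
  note K = assms(3)
  have "open \<Omega>" using assms(5) by (simp add: extension_domain_def)
  then have \<Omega>: "\<Omega> \<in> lmeasurable" "- \<Omega> \<in> sets lebesgue"
    using assms(4) by (auto simp: lmeasurable_open)
  have "\<psi> \<in> Z0_space \<Omega> K"
    using Cc_infinity_in_Z0_space[OF K \<open>open \<Omega>\<close> assms(4) \<psi>] .
  then have \<psi>Z: "\<psi> \<in> Z_space \<Omega> K" and \<psi>out: "AE \<xi> in lebesgue_on (- \<Omega>). \<psi> \<xi> = 0"
    by (auto simp: Z0_space_def)
  have uZ: "u \<in> Z_space \<Omega> K" and uout: "AE \<xi> in lebesgue_on (- \<Omega>). u \<xi> = u0 \<xi>"
    and uin: "AE \<xi> in lebesgue_on \<Omega>. u \<xi> \<le> \<phi> \<xi>"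
    using assms(12) by (auto simp: obstacle_set_def)
  \<comment> \<open>The variational inequality in terms of the increment
    \<open>w = v - u\<close>.\<close>
  have VI: "(\<integral>\<xi>. f \<xi> * w \<xi> \<partial>lebesgue_on \<Omega>) \<le> energy \<Omega> K u w"
    if "w \<in> Z0_space \<Omega> K" "AE \<xi> in lebesgue_on \<Omega>. u \<xi> + w \<xi> \<le> \<phi> \<xi>" for w
  proof -
    have "AE \<xi> in lebesgue_on (- \<Omega>). w \<xi> = 0" using that(1) by (simp add: Z0_space_def)
    with uout have "AE \<xi> in lebesgue_on (- \<Omega>). u \<xi> + w \<xi> = u0 \<xi>"
      by eventually_elim simp
    then have "(\<lambda>\<xi>. u \<xi> + w \<xi>) \<in> obstacle_set \<Omega> K u0 \<phi>"
      using that uZ by (auto simp: obstacle_set_def Z0_space_def intro: Z_space_add)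
    from bspec[OF assms(13) this] show ?thesis by simp
  qed
  have fL2: "in_L2 \<Omega> f" and LL2: "in_L2 \<Omega> L\<phi>"
    using assms(6,11) \<Omega>(1) by (auto simp: has_L_op_def intro: in_Linf_imp_in_L2)
  define F where "F = (\<integral>\<xi>. f \<xi> * \<psi> \<xi> \<partial>lebesgue_on \<Omega>)"
  define H where "H = (\<integral>\<xi>. max (L\<phi> \<xi> + f \<xi>) 0 * \<psi> \<xi> \<partial>lebesgue_on \<Omega>)"
  \<comment> \<open>Lowering \<open>u\<close> by \<open>\<psi>\<close> keeps it below the obstacle,
    so the increment \<open>- \<psi>\<close> is admissible.\<close>
  have "- F \<le> - energy \<Omega> K u \<psi>"
  proof -
    have "AE \<xi> in lebesgue_on \<Omega>. u \<xi> + (- 1) * \<psi> \<xi> \<le> \<phi> \<xi>"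
      using uin
    proof eventually_elim
      case (elim \<xi>)
      then show ?case using \<psi>0[of \<xi>] by simp
    qed
    moreover have "(\<lambda>\<xi>. (- 1) * \<psi> \<xi>) \<in> Z0_space \<Omega> K"
      using Z_space_cmult[OF \<psi>Z, of "- 1"] \<psi>out by (simp add: Z0_space_def)
    ultimately show ?thesis
      using VI[of "\<lambda>\<xi>. (- 1) * \<psi> \<xi>"] energy_cmult_right[OF K, of \<Omega> u "- 1" \<psi>] by (simp add: F_def)
  qed
  moreover have "F - H \<le> energy \<Omega> K u \<psi>"
  proof -
    have approx: "F - H - t * (energy \<Omega> K \<psi> \<psi> / 4) \<le> energy \<Omega> K u \<psi>" if "0 < t" for t
    proof -
      define p where "p \<xi> = max (u \<xi> + t * \<psi> \<xi> - \<phi> \<xi>) 0" for \<xi>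
      \<comment> \<open>Thus \<open>u + w\<close> is the minimum of \<open>u + t * \<psi>\<close>
        and \<open>\<phi>\<close>.\<close>
      define w where "w \<xi> = t * \<psi> \<xi> - p \<xi>" for \<xi>
      have pZ: "p \<in> Z_space \<Omega> K"
        unfolding p_def by (intro Z_space_max_0[OF K] Z_space_diff Z_space_add Z_space_cmult uZ \<psi>Z assms(9))
      have "AE \<xi> in lebesgue_on (- \<Omega>). u0 \<xi> \<le> \<phi> \<xi>"
        using assms(10) \<Omega>(2) by (subst AE_restrict_space_iff) auto
      \<comment> \<open>Outside \<open>\<Omega>\<close> the truncated function is \<open>u0\<close>,
        which is already below \<open>\<phi>\<close>. Hence \<open>p\<close> lies in
        \<open>Z0_space\<close> and may be used to test the equation for
        \<open>\<phi>\<close>.\<close>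
      with uout \<psi>out have pout: "AE \<xi> in lebesgue_on (- \<Omega>). p \<xi> = 0"
        by eventually_elim (simp add: p_def)
      have wZ: "w \<in> Z_space \<Omega> K"
        unfolding w_def by (intro Z_space_diff Z_space_cmult \<psi>Z pZ)
      moreover have "AE \<xi> in lebesgue_on (- \<Omega>). w \<xi> = 0"
        using \<psi>out pout by eventually_elim (simp add: w_def)
      moreover have "AE \<xi> in lebesgue_on \<Omega>. u \<xi> + w \<xi> \<le> \<phi> \<xi>"
        by (rule AE_I2) (simp add: w_def p_def)
      ultimately have 1: "(\<integral>\<xi>. f \<xi> * w \<xi> \<partial>lebesgue_on \<Omega>) \<le> energy \<Omega> K u w"
        by (intro VI) (simp_all add: Z0_space_def)
      have 2: "- energy \<Omega> K \<phi> p = (\<integral>\<xi>. L\<phi> \<xi> * p \<xi> \<partial>lebesgue_on \<Omega>)"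
        using assms(11) pZ pout by (auto simp: has_L_op_def Z0_space_def)
      have 3: "energy \<Omega> K \<phi> p - t\<^sup>2 / 4 * energy \<Omega> K \<psi> \<psi> \<le> energy \<Omega> K u p"
        unfolding p_def by (rule energy_truncation_ge[OF K uZ assms(9) \<psi>Z])
      have 4: "t * energy \<Omega> K u \<psi> = energy \<Omega> K u w + energy \<Omega> K u p"
        using energy_add_right[OF K uZ wZ pZ] by (simp add: w_def energy_cmult_right[OF K])
      have L2: "in_L2 \<Omega> \<psi>" "in_L2 \<Omega> p" "in_L2 \<Omega> w"
        using \<psi>Z pZ wZ by (auto simp: Z_space_def)
      have "in_L2 \<Omega> (\<lambda>\<xi>. max (L\<phi> \<xi> + f \<xi>) 0)"
        using in_L2_add[OF LL2 fL2] by (rule in_L2_bound) (use LL2 fL2 in \<open>auto simp: in_L2_def\<close>)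
      then have int: "integrable (lebesgue_on \<Omega>) (\<lambda>\<xi>. max (L\<phi> \<xi> + f \<xi>) 0 * \<psi> \<xi>)"
        "integrable (lebesgue_on \<Omega>) (\<lambda>\<xi>. f \<xi> * \<psi> \<xi>)"
        "integrable (lebesgue_on \<Omega>) (\<lambda>\<xi>. f \<xi> * w \<xi>)"
        "integrable (lebesgue_on \<Omega>) (\<lambda>\<xi>. L\<phi> \<xi> * p \<xi>)"
        using L2 fL2 LL2 by (auto intro: in_L2_mult_integrable)
      have "t * (F - H) = (\<integral>\<xi>. t * (f \<xi> * \<psi> \<xi> - max (L\<phi> \<xi> + f \<xi>) 0 * \<psi> \<xi>) \<partial>lebesgue_on \<Omega>)"
        using int by (simp add: F_def H_def)
      also have "\<dots> \<le> (\<integral>\<xi>. f \<xi> * w \<xi> - L\<phi> \<xi> * p \<xi> \<partial>lebesgue_on \<Omega>)"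
      proof (rule integral_mono_AE)
        \<comment> \<open>Substituting \<open>w = t * \<psi> - p\<close>, this reduces to comparing
          \<open>(L\<phi> + f) * p\<close> with its positive-part bound. The estimate
          \<open>p \<le> t * \<psi>\<close> comes from \<open>u \<le> \<phi>\<close>.\<close>
        show "AE \<xi> in lebesgue_on \<Omega>. t * (f \<xi> * \<psi> \<xi> - max (L\<phi> \<xi> + f \<xi>) 0 * \<psi> \<xi>) \<le> f \<xi> * w \<xi> - L\<phi> \<xi> * p \<xi>"
          using uin
        proof eventually_elim
          case (elim \<xi>)
          have "0 \<le> t * \<psi> \<xi>" using \<psi>0 that by simp
          then have p: "0 \<le> p \<xi>" "p \<xi> \<le> t * \<psi> \<xi>" using elim by (auto simp: p_def)
          have "(L\<phi> \<xi> + f \<xi>) * p \<xi> \<le> max (L\<phi> \<xi> + f \<xi>) 0 * (t * \<psi> \<xi>)"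
            using p by (intro mult_mono) auto
          then show ?case by (simp add: w_def algebra_simps)
        qed
      qed (use int in auto)
      also have "\<dots> = (\<integral>\<xi>. f \<xi> * w \<xi> \<partial>lebesgue_on \<Omega>) - (\<integral>\<xi>. L\<phi> \<xi> * p \<xi> \<partial>lebesgue_on \<Omega>)"
        using int by simp
      \<comment> \<open>By \<open>4\<close> the energy splits along
        \<open>t * \<psi> = w + p\<close>: \<open>1\<close> bounds the first part below, while
        \<open>3\<close> and \<open>2\<close> bound the second.\<close>
      finally have "t * (F - H) - t\<^sup>2 / 4 * energy \<Omega> K \<psi> \<psi> \<le> t * energy \<Omega> K u \<psi>"
        using 1 2 3 4 by linarith
      then have "t * (F - H - t * (energy \<Omega> K \<psi> \<psi> / 4)) \<le> t * energy \<Omega> K u \<psi>"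
        by (simp add: power2_eq_square right_diff_distrib)
      then show ?thesis using that by (simp add: mult_le_cancel_left_pos)
    qed
    \<comment> \<open>After division by \<open>t\<close> the quadratic error is linear in
      \<open>t\<close> and vanishes as \<open>t\<close> decreases to 0, since the energy of
      \<open>\<psi>\<close> is a fixed real number.\<close>
    have "((\<lambda>t. F - H - t * (energy \<Omega> K \<psi> \<psi> / 4)) \<longlongrightarrow> F - H - 0 * (energy \<Omega> K \<psi> \<psi> / 4)) (at_right 0)"
      by (intro tendsto_intros)
    moreover have "\<forall>\<^sub>F t in at_right 0. F - H - t * (energy \<Omega> K \<psi> \<psi> / 4) \<le> energy \<Omega> K u \<psi>"
      using eventually_at_right_less[of 0] by eventually_elim (rule approx)
    ultimately show ?thesis
      using tendsto_upperbound by fastforce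
  qed
  ultimately show "0 \<le> - energy \<Omega> K u \<psi> + (\<integral>\<xi>. f \<xi> * \<psi> \<xi> \<partial>lebesgue_on \<Omega>) \<and>
      - energy \<Omega> K u \<psi> + (\<integral>\<xi>. f \<xi> * \<psi> \<xi> \<partial>lebesgue_on \<Omega>)
        \<le> (\<integral>\<xi>. max (L\<phi> \<xi> + f \<xi>) 0 * \<psi> \<xi> \<partial>lebesgue_on \<Omega>)"
    by (simp add: F_def H_def)
qed

end
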